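(* Consider the system $(F,L,P,\gamma)$ (as defined in the context). Let $v$ be Gaussian and let $y_i = v + q_i$, $i=1,\dots,k$, be $k$ independent encodings of $v$, where $q_1,\dots,q_k$ are mutually independent, zero-mean, and have a common finite variance $\sigma^2$. If for some $1\le k'\le k$ the common variance satisfies $$\sigma^2 \le \frac{\gamma\, k'\,\|L_yP_{21}S\|^2}{\|S-1\|^2\,(\gamma-\|S-1\|^2)},$$ then $y_1,\dots,y_k$ form a $(k,k')$ stabilizing code for the system $(F,L,P,\gamma)$.
   Context: System. $P$ is an open-loop unstable discrete-time LTI plant with state $x$ and input-output relation $\begin{bmatrix} e \\ y \end{bmatrix}=\begin{bmatrix} P_{11} & P_{12} \\ P_{21} & P_{22} \end{bmatrix}\begin{bmatrix} d \\ u \end{bmatrix}$, where the control input $u$ and the sensor output $y$ are scalar, $d$ is an external disturbance (the disturbance and the initial state are jointly Gaussian), and $e$ is an error signal. The feedback loop is $u=Fw$, $w=v+q$, $v=L_w z^{-1}w+L_y y$, where $F$ and $L=[L_w,L_y]$ are proper LTI filters making the loop internally stable and well posed, $z^{-1}$ is the one-step delay, and $q$ is additive white Gaussian noise of variance $\sigma_q^2$ modelling the coding noise. Put $S=(1-L_wz^{-1}-P_{22}FL_y)^{-1}$ and $K=FL_y(1-L_wz^{-1})^{-1}$. $\|\cdot\|$ is the $H_2$ norm. The signal-to-noise ratio is $\gamma=\sigma_v^2/\sigma_q^2$, where $\sigma_v^2$ is the variance of $v$; it satisfies $\gamma=\|S-1\|^2+\frac1{\sigma_q^2}\|L_yP_{21}S\|^2$.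 $(F,L,P,\gamma)$ denotes such a system, with average rate $\frac12\log_2(1+\gamma)$ and control performance (variance of $e$) $\sigma_e^2=\|P_{11}+P_{12}K(1-P_{22}K)^{-1}P_{21}\|^2+\|P_{12}FS\|^2\sigma_q^2$. Independent encodings: $y_i=v+q_i$, $i=1,\dots,k$, are called independent encodings of $v$ if, for $i\ne j$, $y_i$ and $y_j$ are conditionally independent given $v$. Stabilizing code: a $(k,k')$ stabilizing code for $(F,L,P,\gamma)$ produces $k$ descriptions such that using any $k'$ of them is sufficient to stabilize the system. Descriptions are combined by averaging them, the average taking the role of $w$. Stability means mean-square stability, $\sup_n \mathbb{E}[x(n)x(n)^T]<\infty$, where $x(n)$ is the state at time $n$. *)

theory Defs
  imports "HOL-Probability.Probability"
begin

section \<open>Plant and filters\<close>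

text \<open>
  Linear time-invariant systems are given by state-space realizations
  \<open>x(n+1) = A x(n) + B r(n)\<close>, \<open>t(n) = C x(n) + D r(n)\<close>.  The plant has inputs \<open>d\<close> (vector)
  and \<open>u\<close> (scalar), and outputs \<open>e\<close> (vector) and \<open>y\<close> (scalar).  Rows and columns belonging to
  scalar signals are stored as vectors.  A static filter is the case \<open>A = 0\<close>, \<open>B = C = 0\<close>.
\<close>

record ('n, 'd, 'e) plant =
  pA :: "real ^ 'n ^ 'n"
  pBd :: "real ^ 'd ^ 'n"
  pBu :: "real ^ 'n"
  pCe :: "real ^ 'n ^ 'e"
  pCy :: "real ^ 'n"
  pDed :: "real ^ 'd ^ 'e"
  pDeu :: "real ^ 'e"
  pDyd :: "real ^ 'd"
  pDyu :: real

record 'f filter1 =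
  fA :: "real ^ 'f ^ 'f"
  fB :: "real ^ 'f"
  fC :: "real ^ 'f"
  fD :: real

text \<open>The two-input filter \<open>L = [L\<^sub>w, L\<^sub>y]\<close>, acting on the delayed signal \<open>z\<^sup>-\<^sup>1 w\<close> and on \<open>y\<close>.\<close>

record 'l filter2 =
  lA :: "real ^ 'l ^ 'l"
  lBw :: "real ^ 'l"
  lBy :: "real ^ 'l"
  lC :: "real ^ 'l"
  lDw :: real
  lDy :: real

definition open_loop_unstable :: "('n::finite, 'd::finite, 'e::finite) plant \<Rightarrow> bool" where
  "open_loop_unstable P \<longleftrightarrow> \<not> (\<forall>x. (\<lambda>n. (((*v) (pA P)) ^^ n) x) \<longlonglongrightarrow> 0)"


section \<open>The feedback loop\<close>

text \<open>
  All signals of the loop at one time instant.  \<open>sig_wd\<close> is the content of the one-step delay,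
  i.e. the previous value of \<open>w\<close>.
\<close>

record ('n, 'e, 'f, 'l) signals =
  sig_x :: "real ^ 'n"
  sig_xF :: "real ^ 'f"
  sig_xL :: "real ^ 'l"
  sig_wd :: real
  sig_e :: "real ^ 'e"
  sig_y :: real
  sig_u :: real
  sig_v :: real
  sig_w :: real

definition loop_state ::
  "('n::finite, 'e::finite, 'f::finite, 'l::finite) signals
    \<Rightarrow> (real ^ 'n) \<times> (real ^ 'f) \<times> (real ^ 'l) \<times> real" where
  "loop_state s = (sig_x s, sig_xF s, sig_xL s, sig_wd s)"

text \<open>
  The equations of plant, \<open>u = F w\<close> and \<open>v = L\<^sub>w z\<^sup>-\<^sup>1 w + L\<^sub>y y\<close>.  How \<open>w\<close> is obtained from \<open>v\<close>
  is left open, since it depends on the channel that closes the loop.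
\<close>

definition loop_equations ::
  "('n::finite, 'd::finite, 'e::finite) plant \<Rightarrow> 'f::finite filter1 \<Rightarrow> 'l::finite filter2
    \<Rightarrow> (nat \<Rightarrow> real ^ 'd) \<Rightarrow> (nat \<Rightarrow> ('n, 'e, 'f, 'l) signals) \<Rightarrow> bool" where
  "loop_equations P F L d s \<longleftrightarrow> (\<forall>n.
     sig_x (s (Suc n)) = pA P *v sig_x (s n) + pBd P *v d n + sig_u (s n) *\<^sub>R pBu P \<and>
     sig_e (s n) = pCe P *v sig_x (s n) + pDed P *v d n + sig_u (s n) *\<^sub>R pDeu P \<and>
     sig_y (s n) = pCy P \<bullet> sig_x (s n) + pDyd P \<bullet> d n + pDyu P * sig_u (s n) \<and>
     sig_xF (s (Suc n)) = fA F *v sig_xF (s n) + sig_w (s n) *\<^sub>R fB F \<and>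
     sig_u (s n) = fC F \<bullet> sig_xF (s n) + fD F * sig_w (s n) \<and>
     sig_wd (s (Suc n)) = sig_w (s n) \<and>
     sig_xL (s (Suc n)) =
       lA L *v sig_xL (s n) + sig_wd (s n) *\<^sub>R lBw L + sig_y (s n) *\<^sub>R lBy L \<and>
     sig_v (s n) = lC L \<bullet> sig_xL (s n) + lDw L * sig_wd (s n) + lDy L * sig_y (s n))"

text \<open>
  The delay-free path around the loop \<open>w \<rightarrow> u \<rightarrow> y \<rightarrow> v \<rightarrow> w\<close> has gain \<open>D\<^sub>F D\<^sub>y\<^sub>u D\<^sub>L\<^sub>y\<close>; the loop is
  well posed iff the resulting scalar algebraic equation is uniquely solvable.
\<close>

definition well_posed ::
  "('n::finite, 'd::finite, 'e::finite) plant \<Rightarrow> 'f::finite filter1 \<Rightarrow> 'l::finite filter2 \<Rightarrow> bool"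
  where
  "well_posed P F L \<longleftrightarrow> 1 - lDy L * pDyu P * fD F \<noteq> 0"

text \<open>
  Internal stability: without exogenous signals, all states of the loop (plant, both
  filters and delay) tend to zero from every initial condition.
\<close>

definition internally_stable ::
  "('n::finite, 'd::finite, 'e::finite) plant \<Rightarrow> 'f::finite filter1 \<Rightarrow> 'l::finite filter2 \<Rightarrow> bool"
  where
  "internally_stable P F L \<longleftrightarrow>
     (\<forall>s. loop_equations P F L (\<lambda>_. 0) s \<and> (\<forall>n. sig_w (s n) = sig_v (s n))
        \<longrightarrow> (\<lambda>n. loop_state (s n)) \<longlonglongrightarrow> 0)"


section \<open>Transfer functions and the \<open>H\<^sub>2\<close> norm\<close>

definition cplx_vec :: "real ^ 'n \<Rightarrow> complex ^ 'n" where
  "cplx_vec b = (\<chi> i. complex_of_real (b $ i))"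

definition cplx_mat :: "real ^ 'm ^ 'n \<Rightarrow> complex ^ 'm ^ 'n" where
  "cplx_mat A = (\<chi> i j. complex_of_real (A $ i $ j))"

text \<open>\<open>C (z I - A)\<^sup>-\<^sup>1 B + D\<close> for a scalar input and a scalar output.\<close>

definition transfer_fun ::
  "real ^ 'n ^ 'n \<Rightarrow> real ^ 'n \<Rightarrow> real ^ 'n \<Rightarrow> real \<Rightarrow> complex \<Rightarrow> complex" where
  "transfer_fun A b c \<delta> z =
     (\<Sum>i\<in>UNIV. cplx_vec c $ i * (matrix_inv (mat z - cplx_mat A) *v cplx_vec b) $ i)
     + complex_of_real \<delta>"

definition tf_P21 :: "('n::finite, 'd::finite, 'e::finite) plant \<Rightarrow> complex \<Rightarrow> complex ^ 'd" where
  "tf_P21 P z = (\<chi> j. transfer_fun (pA P) (column j (pBd P)) (pCy P) (pDyd P $ j) z)"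

definition tf_P22 :: "('n::finite, 'd::finite, 'e::finite) plant \<Rightarrow> complex \<Rightarrow> complex" where
  "tf_P22 P = transfer_fun (pA P) (pBu P) (pCy P) (pDyu P)"

definition tf_F :: "'f::finite filter1 \<Rightarrow> complex \<Rightarrow> complex" where
  "tf_F F = transfer_fun (fA F) (fB F) (fC F) (fD F)"

definition tf_Lw :: "'l::finite filter2 \<Rightarrow> complex \<Rightarrow> complex" where
  "tf_Lw L = transfer_fun (lA L) (lBw L) (lC L) (lDw L)"

definition tf_Ly :: "'l::finite filter2 \<Rightarrow> complex \<Rightarrow> complex" where
  "tf_Ly L = transfer_fun (lA L) (lBy L) (lC L) (lDy L)"

definition tf_S ::
  "('n::finite, 'd::finite, 'e::finite) plant \<Rightarrow> 'f::finite filter1 \<Rightarrow> 'l::finite filter2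
    \<Rightarrow> complex \<Rightarrow> complex" where
  "tf_S P F L z = inverse (1 - tf_Lw L z * inverse z - tf_P22 P z * tf_F F z * tf_Ly L z)"

definition tf_LyP21S ::
  "('n::finite, 'd::finite, 'e::finite) plant \<Rightarrow> 'f::finite filter1 \<Rightarrow> 'l::finite filter2
    \<Rightarrow> complex \<Rightarrow> complex ^ 'd" where
  "tf_LyP21S P F L z = (\<chi> j. tf_Ly L z * tf_P21 P z $ j * tf_S P F L z)"

text \<open>
  The functions are evaluated pointwise on the unit circle; the finitely many points where
  open-loop poles cancel do not affect the integral.  On \<open>complex ^ 'd\<close> the norm under the
  integral is the Euclidean (Frobenius) norm.
\<close>

definition H2_norm :: "(complex \<Rightarrow> 'a::real_normed_vector) \<Rightarrow> real" where
  "H2_norm G = sqrt (1 / (2 * pi) * integral {- pi..pi} (\<lambda>\<omega>. (norm (G (cis \<omega>)))\<^sup>2))"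


section \<open>Stochastic signals\<close>

text \<open>Constants count as (degenerate) Gaussian variables.\<close>

definition gaussian_rv :: "'w measure \<Rightarrow> ('w \<Rightarrow> real) \<Rightarrow> bool" where
  "gaussian_rv M X \<longleftrightarrow> X \<in> borel_measurable M \<and>
     (\<exists>\<mu>. (AE \<omega> in M. X \<omega> = \<mu>) \<or>
        (\<exists>\<sigma>>0. distributed M lborel X (\<lambda>t. ennreal (normal_density \<mu> \<sigma> t))))"

definition jointly_gaussian ::
  "'w measure \<Rightarrow> ('w \<Rightarrow> 'a::euclidean_space) \<Rightarrow> (nat \<Rightarrow> 'w \<Rightarrow> 'b::euclidean_space) \<Rightarrow> bool" where
  "jointly_gaussian M \<xi> d \<longleftrightarrow>
     (\<forall>a g N. gaussian_rv M (\<lambda>\<omega>. a \<bullet> \<xi> \<omega> + (\<Sum>n<N. g n \<bullet> d n \<omega>)))"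

definition unit_white_noise :: "'w measure \<Rightarrow> (nat \<Rightarrow> 'w \<Rightarrow> real ^ 'd::finite) \<Rightarrow> bool" where
  "unit_white_noise M d \<longleftrightarrow>
     (\<forall>n i. prob_space.expectation M (\<lambda>\<omega>. d n \<omega> $ i) = 0) \<and>
     (\<forall>n m i j. prob_space.expectation M (\<lambda>\<omega>. d n \<omega> $ i * d m \<omega> $ j)
        = (if n = m \<and> i = j then 1 else 0))"

definition white_gaussian_noise :: "'w measure \<Rightarrow> real \<Rightarrow> (nat \<Rightarrow> 'w \<Rightarrow> real) \<Rightarrow> bool" where
  "white_gaussian_noise M \<sigma> q \<longleftrightarrow> \<sigma> > 0 \<and>
     prob_space.indep_vars M (\<lambda>_. borel) q UNIV \<and>
     (\<forall>n. distributed M lborel (q n) (\<lambda>t. ennreal (normal_density 0 \<sigma> t)))"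

text \<open>
  The system \<open>(F, L, P, \<gamma>)\<close>: \<open>\<xi>\<close> is the initial state of the loop, \<open>q\<close> the coding noise with
  standard deviation \<open>\<sigma>q\<close>, and \<open>s\<close> the resulting signals with \<open>w = v + q\<close>.  The
  disturbance has unit covariance, which is the normalization under which
  \<open>\<gamma> = \<parallel>S - 1\<parallel>\<^sup>2 + \<parallel>L\<^sub>y P\<^sub>2\<^sub>1 S\<parallel>\<^sup>2 / \<sigma>q\<^sup>2\<close>.  As the loop is started at time 0, the variance of \<open>v\<close> is
  the stationary one, i.e. the limit of the variances of \<open>v(n)\<close>.
\<close>

definition networked_system ::
  "'w measure \<Rightarrow> ('n::finite, 'd::finite, 'e::finite) plant \<Rightarrow> 'f::finite filter1
    \<Rightarrow> 'l::finite filter2 \<Rightarrow> real \<Rightarrow> ('w \<Rightarrow> (real ^ 'n) \<times> (real ^ 'f) \<times> (real ^ 'l) \<times> real)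
    \<Rightarrow> (nat \<Rightarrow> 'w \<Rightarrow> real ^ 'd) \<Rightarrow> real \<Rightarrow> (nat \<Rightarrow> 'w \<Rightarrow> real)
    \<Rightarrow> (nat \<Rightarrow> 'w \<Rightarrow> ('n, 'e, 'f, 'l) signals) \<Rightarrow> bool" where
  "networked_system M P F L \<gamma> \<xi> d \<sigma>q q s \<longleftrightarrow>
     prob_space M \<and>
     open_loop_unstable P \<and> well_posed P F L \<and> internally_stable P F L \<and>
     jointly_gaussian M \<xi> d \<and> unit_white_noise M d \<and>
     white_gaussian_noise M \<sigma>q q \<and>
     prob_space.indep_set M
       (sets (vimage_algebra (space M) (\<lambda>\<omega>. (\<xi> \<omega>, \<lambda>n. d n \<omega>))
          (borel \<Otimes>\<^sub>M (\<Pi>\<^sub>M n\<in>UNIV. borel))))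
       (sets (vimage_algebra (space M) (\<lambda>\<omega> n. q n \<omega>) (\<Pi>\<^sub>M n\<in>UNIV. borel))) \<and>
     (\<forall>\<omega>\<in>space M. loop_equations P F L (\<lambda>n. d n \<omega>) (\<lambda>n. s n \<omega>) \<and>
        loop_state (s 0 \<omega>) = \<xi> \<omega> \<and>
        (\<forall>n. sig_w (s n \<omega>) = sig_v (s n \<omega>) + q n \<omega>)) \<and>
     (\<exists>\<sigma>v2. (\<lambda>n. prob_space.variance M (\<lambda>\<omega>. sig_v (s n \<omega>))) \<longlonglongrightarrow> \<sigma>v2 \<and> \<gamma> = \<sigma>v2 / \<sigma>q\<^sup>2)"


section \<open>Independent encodings and stabilizing codes\<close>

definition cond_indep_given ::
  "'w measure \<Rightarrow> ('w \<Rightarrow> real) \<Rightarrow> ('w \<Rightarrow> real) \<Rightarrow> ('w \<Rightarrow> real) \<Rightarrow> bool" where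
  "cond_indep_given M V X Y \<longleftrightarrow>
     (let \<F> = vimage_algebra (space M) V borel in
      \<forall>A\<in>sets borel. \<forall>B\<in>sets borel. AE \<omega> in M.
        real_cond_exp M \<F> (\<lambda>\<omega>. indicator A (X \<omega>) * indicator B (Y \<omega>)) \<omega>
        = real_cond_exp M \<F> (\<lambda>\<omega>. indicator A (X \<omega>)) \<omega>
          * real_cond_exp M \<F> (\<lambda>\<omega>. indicator B (Y \<omega>)) \<omega>)"

definition independent_encodings ::
  "'w measure \<Rightarrow> nat \<Rightarrow> ('w \<Rightarrow> real) \<Rightarrow> (nat \<Rightarrow> 'w \<Rightarrow> real) \<Rightarrow> bool" where
  "independent_encodings M k V Y \<longleftrightarrow>
     (\<forall>i\<in>{1..k}. \<forall>j\<in>{1..k}. i \<noteq> j \<longrightarrow> cond_indep_given M V (Y i) (Y j))"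

text \<open>
  The loop closed through the descriptions \<open>y i\<close>, \<open>i \<in> I\<close>: their average takes the role of \<open>w\<close>.
\<close>

definition closed_through ::
  "'w measure \<Rightarrow> ('n::finite, 'd::finite, 'e::finite) plant \<Rightarrow> 'f::finite filter1
    \<Rightarrow> 'l::finite filter2 \<Rightarrow> ('w \<Rightarrow> (real ^ 'n) \<times> (real ^ 'f) \<times> (real ^ 'l) \<times> real)
    \<Rightarrow> (nat \<Rightarrow> 'w \<Rightarrow> real ^ 'd) \<Rightarrow> nat set \<Rightarrow> (nat \<Rightarrow> nat \<Rightarrow> 'w \<Rightarrow> real)
    \<Rightarrow> (nat \<Rightarrow> 'w \<Rightarrow> ('n, 'e, 'f, 'l) signals) \<Rightarrow> bool" where
  "closed_through M P F L \<xi> d I y s \<longleftrightarrow>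
     (\<forall>\<omega>\<in>space M. loop_equations P F L (\<lambda>n. d n \<omega>) (\<lambda>n. s n \<omega>) \<and>
        loop_state (s 0 \<omega>) = \<xi> \<omega> \<and>
        (\<forall>n. sig_w (s n \<omega>) = (\<Sum>i\<in>I. y i n \<omega>) / real (card I)))"

text \<open>\<open>sup\<^sub>n E[x(n) x(n)\<^sup>T] < \<infinity>\<close>; integrability is explicit since non-existing integrals are 0.\<close>

definition mean_square_stable :: "'w measure \<Rightarrow> (nat \<Rightarrow> 'w \<Rightarrow> real ^ 'n::finite) \<Rightarrow> bool" where
  "mean_square_stable M x \<longleftrightarrow>
     (\<forall>n i j. integrable M (\<lambda>\<omega>. x n \<omega> $ i * x n \<omega> $ j)) \<and>
     bounded (range (\<lambda>n. (\<chi> i j. prob_space.expectation M (\<lambda>\<omega>. x n \<omega> $ i * x n \<omega> $ j))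
       :: real ^ 'n ^ 'n))"

text \<open>
  In closed loop, the encoded signal \<open>v\<close> and hence the descriptions depend on which
  descriptions are used.  Therefore \<open>s I\<close> and \<open>y I\<close> are the signals and the descriptions
  \<open>y\<^sub>1, \<dots>, y\<^sub>k\<close> that occur when the loop is closed through the descriptions in \<open>I\<close>.
\<close>

definition stabilizing_code ::
  "'w measure \<Rightarrow> ('n::finite, 'd::finite, 'e::finite) plant \<Rightarrow> 'f::finite filter1
    \<Rightarrow> 'l::finite filter2 \<Rightarrow> ('w \<Rightarrow> (real ^ 'n) \<times> (real ^ 'f) \<times> (real ^ 'l) \<times> real)
    \<Rightarrow> (nat \<Rightarrow> 'w \<Rightarrow> real ^ 'd) \<Rightarrow> nat \<Rightarrow> nat
    \<Rightarrow> (nat set \<Rightarrow> nat \<Rightarrow> 'w \<Rightarrow> ('n, 'e, 'f, 'l) signals)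
    \<Rightarrow> (nat set \<Rightarrow> nat \<Rightarrow> nat \<Rightarrow> 'w \<Rightarrow> real) \<Rightarrow> bool" where
  "stabilizing_code M P F L \<xi> d k k' s y \<longleftrightarrow>
     (\<forall>I. I \<subseteq> {1..k} \<and> card I = k' \<longrightarrow>
        closed_through M P F L \<xi> d I (y I) (s I) \<and>
        mean_square_stable M (\<lambda>n \<omega>. sig_x (s I n \<omega>)))"

end

theory Submission
  imports Defs
begin

text \<open>
  Closing the loop through an average of descriptions leaves the loop dynamics unchanged and only
  replaces the coding noise by the average of the noises.  Hence the loop state obeys
  \<open>z(n+1) = \<Phi> z(n) + g(n)\<close> where \<open>\<Phi>\<close> is the map of the noise-free loop, and \<open>g(n)\<close> is linear in the
  disturbance and the averaged noise, so that its second moment is bounded in \<open>n\<close>.  Internal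
  stability makes some power \<open>\<Phi>\<^sup>N\<close> a contraction, which yields the pointwise estimate
  \<open>|z(n+N)|\<^sup>2 \<le> |z(n)|\<^sup>2 / 2 + C (|g(n)|\<^sup>2 + \<dots> + |g(n+N-1)|\<^sup>2)\<close>.  Taking expectations bounds the second
  moment of the state.
\<close>

section \<open>Pathwise estimates for stable linear recursions\<close>

lemma power2_norm_add_le:
  fixes a b :: "'a::real_normed_vector"
  shows "(norm (a + b))\<^sup>2 \<le> 2 * (norm a)\<^sup>2 + 2 * (norm b)\<^sup>2"
proof -
  have "(norm (a + b))\<^sup>2 \<le> (norm a + norm b)\<^sup>2"
    by (simp add: norm_triangle_ineq power_mono)
  also have "\<dots> \<le> 2 * (norm a)\<^sup>2 + 2 * (norm b)\<^sup>2"
    using sum_squares_bound[of "norm a" "norm b"] by (simp add: power2_sum)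
  finally show ?thesis .
qed

lemma linear_funpow:
  fixes f :: "'a::real_vector \<Rightarrow> 'a"
  assumes "linear f"
  shows "linear (f ^^ n)"
proof (induction n)
  case 0
  then show ?case by (simp add: linear_id[unfolded id_def] id_def)
next
  case (Suc n)
  from linear_compose[OF this assms] show ?case by (simp add: comp_def)
qed

text \<open>In finite dimension, pointwise decay on the basis gives decay in operator norm:
  \<open>norm ((f ^^ n) x)\<close> is at most \<open>norm x\<close> times the sum of the norms of
  the basis images, and this finite sum tends to 0.\<close>

lemma stable_linear_power_contracts:
  fixes f :: "'a::euclidean_space \<Rightarrow> 'a"
  assumes lin: "linear f" and stable: "\<And>x. (\<lambda>n. (f ^^ n) x) \<longlonglongrightarrow> 0"
  obtains N where "N > 0" "\<And>x. norm ((f ^^ N) x) \<le> norm x / 2"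
proof -
  have "(\<lambda>n. \<Sum>b\<in>Basis. norm ((f ^^ n) b)) \<longlonglongrightarrow> (\<Sum>b\<in>(Basis::'a set). norm (0::'a))"
    by (intro tendsto_sum tendsto_norm stable)
  then have "eventually (\<lambda>n. (\<Sum>b\<in>Basis. norm ((f ^^ n) b)) < 1/2) sequentially"
    by (rule order_tendstoD) simp
  \<comment> \<open>Positivity of \<open>N\<close> is recorded because a later induction steps back
    from \<open>n\<close> to \<open>n - N\<close>.\<close>
  then have "eventually (\<lambda>n. (\<Sum>b\<in>Basis. norm ((f ^^ n) b)) < 1/2 \<and> n > 0) sequentially"
    using eventually_gt_at_top by (rule eventually_conj)
  then obtain N where N: "(\<Sum>b\<in>Basis. norm ((f ^^ N) b)) < 1/2" "N > 0"
    by (auto simp: eventually_sequentially)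
  have "norm ((f ^^ N) x) \<le> norm x / 2" for x
  proof -
    have "(f ^^ N) x = (f ^^ N) (\<Sum>b\<in>Basis. (x \<bullet> b) *\<^sub>R b)"
      by (simp add: euclidean_representation)
    also have "\<dots> = (\<Sum>b\<in>Basis. (x \<bullet> b) *\<^sub>R (f ^^ N) b)"
      using linear_funpow[OF lin] by (simp add: linear_sum linear_cmul)
    also have "norm \<dots> \<le> (\<Sum>b\<in>Basis. norm x * norm ((f ^^ N) b))"
      by (intro sum_norm_le) (auto intro!: mult_right_mono Basis_le_norm)
    also have "\<dots> \<le> norm x * (1/2)"
      unfolding sum_distrib_left[symmetric] using N by (intro mult_left_mono) auto
    finally show ?thesis by simp
  qed
  with N that show ?thesis by blast
qed

text \<open>After \<open>N\<close> steps the state is the free response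
  \<open>(f ^^ N) (z n)\<close> plus an error accumulated from the inputs. Squaring the sum costs a
  factor 2, so the contraction factor 1/2 becomes 2 * (1/4) = 1/2, still below 1.\<close>

lemma linear_recursion_estimate:
  fixes f :: "'a::euclidean_space \<Rightarrow> 'a" and z g :: "nat \<Rightarrow> 'a"
  assumes lin: "linear f" and B: "\<And>x. norm (f x) \<le> B * norm x" "B \<ge> 1"
    and N: "\<And>x. norm ((f ^^ N) x) \<le> norm x / 2"
    and z: "\<And>n. z (Suc n) = f (z n) + g n"
  shows "(norm (z (n + N)))\<^sup>2 \<le> (norm (z n))\<^sup>2 / 2 + 2 * B ^ (2*N) * N * (\<Sum>j<N. (norm (g (n + j)))\<^sup>2)"
proof -
  \<comment> \<open>The input at offset \<open>j\<close> is propagated \<open>m - 1 - j\<close>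
    times, hence weighted by at most \<open>B ^ (m - 1 - j)\<close>. As \<open>B \<ge> 1\<close>,
    the single weight \<open>B ^ m\<close> serves for all offsets.\<close>
  have dev: "norm (z (n + m) - (f ^^ m) (z n)) \<le> B ^ m * (\<Sum>j<m. norm (g (n + j)))" for m
  proof (induction m)
    case (Suc m)
    have "z (n + Suc m) - (f ^^ Suc m) (z n) = f (z (n + m) - (f ^^ m) (z n)) + g (n + m)"
      by (simp add: z linear_diff[OF lin])
    also have "norm \<dots> \<le> B * norm (z (n + m) - (f ^^ m) (z n)) + norm (g (n + m))"
      using B(1) norm_triangle_ineq order_trans add_right_mono by blast
    also have "\<dots> \<le> B * (B ^ m * (\<Sum>j<m. norm (g (n + j)))) + B ^ Suc m * norm (g (n + m))"
      using B(2) Suc mult_right_mono[OF one_le_power[OF B(2), of "Suc m"], of "norm (g (n + m))"]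
      by (intro add_mono mult_left_mono) auto
    also have "\<dots> = B ^ Suc m * (\<Sum>j<Suc m. norm (g (n + j)))"
      by (simp add: algebra_simps)
    finally show ?case .
  qed simp
  let ?b = "z (n + N) - (f ^^ N) (z n)"
  have "(norm (z (n + N)))\<^sup>2 = (norm ((f ^^ N) (z n) + ?b))\<^sup>2" by simp
  also have "\<dots> \<le> 2 * (norm ((f ^^ N) (z n)))\<^sup>2 + 2 * (norm ?b)\<^sup>2"
    by (rule power2_norm_add_le)
  also have "\<dots> \<le> 2 * (norm (z n) / 2)\<^sup>2 + 2 * (B ^ N * (\<Sum>j<N. norm (g (n + j))))\<^sup>2"
    by (intro add_mono mult_left_mono power_mono N dev) auto
  also have "\<dots> = (norm (z n))\<^sup>2 / 2 + 2 * B ^ (2*N) * (\<Sum>j<N. norm (g (n + j)))\<^sup>2"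
    by (simp add: power_mult_distrib power_divide power_mult[symmetric] mult.commute)
  \<comment> \<open>Cauchy-Schwarz for a sum of \<open>N\<close> terms produces the factor
    \<open>N\<close>.\<close>
  also have "\<dots> \<le> (norm (z n))\<^sup>2 / 2 + 2 * B ^ (2*N) * ((\<Sum>j<N. (norm (g (n + j)))\<^sup>2) * N)"
    using sum_squared_le_sum_of_squares[of "\<lambda>j. norm (g (n + j))" "{..<N}"] B(2)
    by (intro add_mono mult_left_mono) auto
  finally show ?thesis by (simp add: mult_ac)
qed

section \<open>Square-integrable random vectors\<close>

definition square_integrable :: "'w measure \<Rightarrow> ('w \<Rightarrow> 'a::euclidean_space) \<Rightarrow> bool" where
  "square_integrable M X \<longleftrightarrow> X \<in> borel_measurable M \<and> integrable M (\<lambda>\<omega>. (norm (X \<omega>))\<^sup>2)"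

lemma square_integrable_add:
  assumes "square_integrable M X" "square_integrable M Y"
  shows "square_integrable M (\<lambda>\<omega>. X \<omega> + Y \<omega>)"
proof -
  have [measurable]: "X \<in> borel_measurable M" "Y \<in> borel_measurable M"
    using assms by (auto simp: square_integrable_def)
  have "integrable M (\<lambda>\<omega>. 2 * (norm (X \<omega>))\<^sup>2 + 2 * (norm (Y \<omega>))\<^sup>2)"
    using assms by (auto simp: square_integrable_def)
  then have "integrable M (\<lambda>\<omega>. (norm (X \<omega> + Y \<omega>))\<^sup>2)"
    by (rule Bochner_Integration.integrable_bound) (auto intro!: AE_I2 power2_norm_add_le)
  then show ?thesis by (simp add: square_integrable_def)
qed

lemma square_integrable_linear:
  fixes f :: "'a::euclidean_space \<Rightarrow> 'b::euclidean_space"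
  assumes f: "linear f" and B: "\<And>x. norm (f x) \<le> B * norm x" and X: "square_integrable M X"
  shows "square_integrable M (\<lambda>\<omega>. f (X \<omega>))"
    and "(\<integral>\<omega>. (norm (f (X \<omega>)))\<^sup>2 \<partial>M) \<le> B\<^sup>2 * (\<integral>\<omega>. (norm (X \<omega>))\<^sup>2 \<partial>M)"
proof -
  have [measurable]: "X \<in> borel_measurable M"
    using X by (auto simp: square_integrable_def)
  have [measurable]: "f \<in> borel_measurable borel"
    using f by (intro borel_measurable_continuous_onI linear_continuous_on linear_conv_bounded_linear[THEN iffD1])
  have le: "(norm (f x))\<^sup>2 \<le> B\<^sup>2 * (norm x)\<^sup>2" for x
    using power_mono[OF B, of x 2] by (simp add: power_mult_distrib)
  have int: "integrable M (\<lambda>\<omega>. B\<^sup>2 * (norm (X \<omega>))\<^sup>2)"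
    using X by (auto simp: square_integrable_def)
  then have int': "integrable M (\<lambda>\<omega>. (norm (f (X \<omega>)))\<^sup>2)"
    by (rule Bochner_Integration.integrable_bound) (auto intro!: AE_I2 le)
  then show "square_integrable M (\<lambda>\<omega>. f (X \<omega>))" by (simp add: square_integrable_def)
  have "(\<integral>\<omega>. (norm (f (X \<omega>)))\<^sup>2 \<partial>M) \<le> (\<integral>\<omega>. B\<^sup>2 * (norm (X \<omega>))\<^sup>2 \<partial>M)"
    by (intro integral_mono int int' le)
  then show "(\<integral>\<omega>. (norm (f (X \<omega>)))\<^sup>2 \<partial>M) \<le> B\<^sup>2 * (\<integral>\<omega>. (norm (X \<omega>))\<^sup>2 \<partial>M)" by simp
qed

text \<open>The Gaussian and white-noise hypotheses speak about scalar functionals and coordinates.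
  This is the passage from there to vectors, based on the squared norm being the sum of the squared
  coordinates.\<close>

lemma square_integrable_componentwise:
  fixes X :: "'w \<Rightarrow> 'a::euclidean_space"
  assumes "\<And>b. b \<in> Basis \<Longrightarrow> square_integrable M (\<lambda>\<omega>. X \<omega> \<bullet> b)"
  shows "square_integrable M X"
    and "(\<integral>\<omega>. (norm (X \<omega>))\<^sup>2 \<partial>M) = (\<Sum>b\<in>Basis. \<integral>\<omega>. (X \<omega> \<bullet> b)\<^sup>2 \<partial>M)"
proof -
  have eq: "(norm x)\<^sup>2 = (\<Sum>b\<in>Basis. (x \<bullet> b)\<^sup>2)" for x :: 'a
    unfolding dot_square_norm[symmetric] by (subst euclidean_inner) (simp add: power2_eq_square)
  have int: "integrable M (\<lambda>\<omega>. (X \<omega> \<bullet> b)\<^sup>2)" if "b \<in> Basis" for b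
    using assms[OF that] by (simp add: square_integrable_def)
  show "square_integrable M X"
    unfolding square_integrable_def
  proof
    show "X \<in> borel_measurable M"
      by (subst borel_measurable_euclidean_space) (use assms in \<open>auto simp: square_integrable_def\<close>)
    show "integrable M (\<lambda>\<omega>. (norm (X \<omega>))\<^sup>2)"
      unfolding eq by (intro Bochner_Integration.integrable_sum int)
  qed
  show "(\<integral>\<omega>. (norm (X \<omega>))\<^sup>2 \<partial>M) = (\<Sum>b\<in>Basis. \<integral>\<omega>. (X \<omega> \<bullet> b)\<^sup>2 \<partial>M)"
    unfolding eq by (intro Bochner_Integration.integral_sum int)
qed

lemma square_integrable_Pair:
  assumes X: "square_integrable M X" and Y: "square_integrable M Y"
  shows "square_integrable M (\<lambda>\<omega>. (X \<omega>, Y \<omega>))"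
    and "(\<integral>\<omega>. (norm (X \<omega>, Y \<omega>))\<^sup>2 \<partial>M) = (\<integral>\<omega>. (norm (X \<omega>))\<^sup>2 \<partial>M) + (\<integral>\<omega>. (norm (Y \<omega>))\<^sup>2 \<partial>M)"
  using assms by (auto simp: square_integrable_def norm_Pair intro!: Bochner_Integration.integral_add)

section \<open>Bounded second moments of stable linear recursions\<close>

lemma contracting_sequence_bounded:
  fixes a :: "nat \<Rightarrow> real"
  assumes N: "N > 0" and a: "\<And>n. a (n + N) \<le> a n / 2 + c"
  shows "\<exists>K. \<forall>n. a n \<le> K"
proof -
  \<comment> \<open>The map t -> t/2 + c preserves the condition t \<le> K as soon as
    \<open>2 * c \<le> K\<close>. The maximum over the first \<open>N\<close> values covers the
    starting block of the induction.\<close>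
  define K where "K = Max (insert (2 * c) (a ` {..<N}))"
  have K: "2 * c \<le> K" "\<And>n. n < N \<Longrightarrow> a n \<le> K"
    by (auto simp: K_def intro!: Max_ge)
  have "a n \<le> K" for n
  proof (induction n rule: less_induct)
    case (less n)
    show ?case
    proof (cases "n < N")
      case False
      then have "a n \<le> a (n - N) / 2 + c" using a[of "n - N"] by simp
      then show ?thesis using less[of "n - N"] False N K(1) by fastforce
    qed (rule K)
  qed
  then show ?thesis by blast
qed

text \<open>Integrating the pathwise estimate gives a(n+N) \<le> a(n)/2 + c for the second moments
  a(n) of the state. Working pathwise first avoids any covariance between state and input.\<close>

proposition linear_recursion_second_moment_bounded:
  fixes f :: "'a::euclidean_space \<Rightarrow> 'a" and z g :: "nat \<Rightarrow> 'w \<Rightarrow> 'a"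
  assumes lin: "linear f" and stable: "\<And>x. (\<lambda>n. (f ^^ n) x) \<longlonglongrightarrow> 0"
    and z0: "square_integrable M (z 0)"
    and g: "\<And>n. square_integrable M (g n)" "\<And>n. (\<integral>\<omega>. (norm (g n \<omega>))\<^sup>2 \<partial>M) \<le> G"
    and z: "\<And>n \<omega>. \<omega> \<in> space M \<Longrightarrow> z (Suc n) \<omega> = f (z n \<omega>) + g n \<omega>"
  shows "square_integrable M (z n)" and "\<exists>K. \<forall>n. (\<integral>\<omega>. (norm (z n \<omega>))\<^sup>2 \<partial>M) \<le> K"
proof -
  obtain N where N: "N > 0" "\<And>x. norm ((f ^^ N) x) \<le> norm x / 2"
    using stable_linear_power_contracts[OF lin stable] by blast
  obtain B0 where B0: "\<And>x. norm (f x) \<le> B0 * norm x"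
    using linear_bounded[OF lin] by blast
  \<comment> \<open>The maximum with 1 provides the condition \<open>B \<ge> 1\<close> of
    \<open>linear_recursion_estimate\<close>.\<close>
  define B where "B = max 1 B0"
  have B: "norm (f x) \<le> B * norm x" "B \<ge> 1" for x
    using B0[of x] mult_right_mono[of B0 B "norm x"] by (auto simp: B_def intro: order_trans)
  have sq: "square_integrable M (z n)" for n
  proof (induction n)
    case (Suc n)
    have "square_integrable M (\<lambda>\<omega>. f (z n \<omega>) + g n \<omega>)"
      by (intro square_integrable_add square_integrable_linear[OF lin B(1)] Suc g)
    \<comment> \<open>The recursion holds on \<open>space M\<close> only, so measurability and
      integrability are transferred by congruence there.\<close>
    moreover have "square_integrable M (z (Suc n)) \<longleftrightarrow> square_integrable M (\<lambda>\<omega>. f (z n \<omega>) + g n \<omega>)"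
      unfolding square_integrable_def
      by (intro conj_cong measurable_cong Bochner_Integration.integrable_cong) (auto simp: z)
    ultimately show ?case by simp
  qed (rule z0)
  then show "square_integrable M (z n)" .
  have int: "integrable M (\<lambda>\<omega>. (norm (z n \<omega>))\<^sup>2)" "integrable M (\<lambda>\<omega>. (norm (g n \<omega>))\<^sup>2)" for n
    using sq g(1) by (auto simp: square_integrable_def)
  define C where "C = 2 * B ^ (2*N) * N"
  have C: "C \<ge> 0" using B(2) by (simp add: C_def)
  have "(\<integral>\<omega>. (norm (z (n + N) \<omega>))\<^sup>2 \<partial>M) \<le> (\<integral>\<omega>. (norm (z n \<omega>))\<^sup>2 \<partial>M) / 2 + C * (N * G)" for n
  proof -
    have "(\<integral>\<omega>. (norm (z (n + N) \<omega>))\<^sup>2 \<partial>M)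
        \<le> (\<integral>\<omega>. (norm (z n \<omega>))\<^sup>2 / 2 + C * (\<Sum>j<N. (norm (g (n + j) \<omega>))\<^sup>2) \<partial>M)"
    proof (intro integral_mono)
      fix \<omega> assume "\<omega> \<in> space M"
      then show "(norm (z (n + N) \<omega>))\<^sup>2 \<le> (norm (z n \<omega>))\<^sup>2 / 2 + C * (\<Sum>j<N. (norm (g (n + j) \<omega>))\<^sup>2)"
        unfolding C_def
        by (intro linear_recursion_estimate[of f B N "\<lambda>n. z n \<omega>" "\<lambda>n. g n \<omega>"] lin B N z)
    qed (use int in auto)
    also have "\<dots> = (\<integral>\<omega>. (norm (z n \<omega>))\<^sup>2 \<partial>M) / 2 + C * (\<Sum>j<N. \<integral>\<omega>. (norm (g (n + j) \<omega>))\<^sup>2 \<partial>M)"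
      using int by (subst Bochner_Integration.integral_add) (auto simp: Bochner_Integration.integral_sum)
    also have "\<dots> \<le> (\<integral>\<omega>. (norm (z n \<omega>))\<^sup>2 \<partial>M) / 2 + C * (\<Sum>j<N. G)"
      by (intro add_mono mult_left_mono sum_mono g C order_refl)
    finally show ?thesis by simp
  qed
  then show "\<exists>K. \<forall>n. (\<integral>\<omega>. (norm (z n \<omega>))\<^sup>2 \<partial>M) \<le> K"
    by (rule contracting_sequence_bounded[OF N(1)])
qed

text \<open>Joint Gaussianity enters through this fact, applied to the coordinates of the initial
  state and of the disturbance.\<close>

lemma (in prob_space) gaussian_rv_square_integrable:
  assumes "gaussian_rv M X"
  shows "square_integrable M X"
proof -
  have [measurable]: "X \<in> borel_measurable M" using assms by (simp add: gaussian_rv_def)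
  obtain \<mu> where "(AE \<omega> in M. X \<omega> = \<mu>) \<or>
      (\<exists>\<sigma>>0. distributed M lborel X (\<lambda>t. ennreal (normal_density \<mu> \<sigma> t)))"
    using assms by (auto simp: gaussian_rv_def)
  then have "integrable M (\<lambda>\<omega>. (X \<omega>)\<^sup>2)"
  proof
    assume "AE \<omega> in M. X \<omega> = \<mu>"
    then have "integrable M (\<lambda>\<omega>. (X \<omega>)\<^sup>2) \<longleftrightarrow> integrable M (\<lambda>\<omega>. \<mu>\<^sup>2)"
      by (intro integrable_cong_AE) auto
    then show ?thesis by simp
  next
    assume "\<exists>\<sigma>>0. distributed M lborel X (\<lambda>t. ennreal (normal_density \<mu> \<sigma> t))"
    then obtain \<sigma> where \<sigma>: "\<sigma> > 0"
      and X: "distributed M lborel X (\<lambda>t. ennreal (normal_density \<mu> \<sigma> t))" by blast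
    \<comment> \<open>The moments of order 2, 1 and 0 about the mean combine to the raw second
      moment via t^2 = (t - \<mu>)^2 + 2 \<mu> (t - \<mu>) + \<mu>^2.\<close>
    have "integrable lborel (\<lambda>t. normal_density \<mu> \<sigma> t * (t - \<mu>) ^ 2)"
         "integrable lborel (\<lambda>t. normal_density \<mu> \<sigma> t * (t - \<mu>) ^ 1)"
         "integrable lborel (normal_density \<mu> \<sigma>)"
      using \<sigma> by (intro integrable_normal_moment integrable_normal_density; simp)+
    then have "integrable lborel (\<lambda>t. normal_density \<mu> \<sigma> t * (t - \<mu>) ^ 2
        + 2 * \<mu> * (normal_density \<mu> \<sigma> t * (t - \<mu>) ^ 1) + \<mu>\<^sup>2 * normal_density \<mu> \<sigma> t)"
      by simp
    also have "(\<lambda>t. normal_density \<mu> \<sigma> t * (t - \<mu>) ^ 2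
        + 2 * \<mu> * (normal_density \<mu> \<sigma> t * (t - \<mu>) ^ 1) + \<mu>\<^sup>2 * normal_density \<mu> \<sigma> t)
        = (\<lambda>t. normal_density \<mu> \<sigma> t * t\<^sup>2)"
      by (simp add: fun_eq_iff power2_eq_square algebra_simps)
    finally show ?thesis
      by (subst distributed_integrable[OF X, symmetric]) auto
  qed
  then show ?thesis by (simp add: square_integrable_def)
qed


section \<open>The loop as a linear system\<close>

type_synonym ('n, 'f, 'l) lstate = "(real ^ 'n) \<times> (real ^ 'f) \<times> (real ^ 'l) \<times> real"

text \<open>
  Eliminating \<open>w = v + q\<close>, \<open>u\<close> and \<open>y\<close> from the delay-free equations leaves a scalar equation for
  \<open>v\<close>, which is solved here.
\<close>

definition loop_v ::
  "('n::finite, 'd::finite, 'e::finite) plant \<Rightarrow> 'f::finite filter1 \<Rightarrow> 'l::finite filter2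
    \<Rightarrow> ('n, 'f, 'l) lstate \<times> (real ^ 'd) \<times> real \<Rightarrow> real" where
  "loop_v P F L = (\<lambda>((x, xF, xL, wd), dn, qn).
     (lC L \<bullet> xL + lDw L * wd + lDy L * (pCy P \<bullet> x + pDyd P \<bullet> dn + pDyu P * (fC F \<bullet> xF + fD F * qn)))
      / (1 - lDy L * pDyu P * fD F))"

definition loop_u ::
  "('n::finite, 'd::finite, 'e::finite) plant \<Rightarrow> 'f::finite filter1 \<Rightarrow> 'l::finite filter2
    \<Rightarrow> ('n, 'f, 'l) lstate \<times> (real ^ 'd) \<times> real \<Rightarrow> real" where
  "loop_u P F L = (\<lambda>((x, xF, xL, wd), dn, qn).
     fC F \<bullet> xF + fD F * (loop_v P F L ((x, xF, xL, wd), dn, qn) + qn))"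

definition loop_y ::
  "('n::finite, 'd::finite, 'e::finite) plant \<Rightarrow> 'f::finite filter1 \<Rightarrow> 'l::finite filter2
    \<Rightarrow> ('n, 'f, 'l) lstate \<times> (real ^ 'd) \<times> real \<Rightarrow> real" where
  "loop_y P F L = (\<lambda>((x, xF, xL, wd), dn, qn).
     pCy P \<bullet> x + pDyd P \<bullet> dn + pDyu P * loop_u P F L ((x, xF, xL, wd), dn, qn))"

text \<open>State, disturbance and noise form one argument, so that linearity can be stated jointly
  in all of them and superposition separates the free motion from the effect of the inputs.\<close>

definition loop_step ::
  "('n::finite, 'd::finite, 'e::finite) plant \<Rightarrow> 'f::finite filter1 \<Rightarrow> 'l::finite filter2
    \<Rightarrow> ('n, 'f, 'l) lstate \<times> (real ^ 'd) \<times> real \<Rightarrow> ('n, 'f, 'l) lstate" where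
  "loop_step P F L = (\<lambda>((x, xF, xL, wd), dn, qn).
     let a = ((x, xF, xL, wd), dn, qn); w = loop_v P F L a + qn in
     (pA P *v x + pBd P *v dn + loop_u P F L a *\<^sub>R pBu P,
      fA F *v xF + w *\<^sub>R fB F,
      lA L *v xL + wd *\<^sub>R lBw L + loop_y P F L a *\<^sub>R lBy L,
      w))"

lemma linear_loop_v: "linear (loop_v P F L)"
  by (rule linearI)
    (auto simp: loop_v_def inner_add_right add_divide_distrib[symmetric] algebra_simps)

lemma linear_loop_u: "linear (loop_u P F L)"
proof -
  \<comment> \<open>With projections instead of a tuple pattern, \<open>loop_v\<close> is applied to
    a plain variable, and its additivity and homogeneity can be used as rewrite rules.\<close>
  have "linear (\<lambda>a. fC F \<bullet> fst (snd (fst a)) + fD F * (loop_v P F L a + snd (snd a)))"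
    by (rule linearI)
      (auto simp: linear_add[OF linear_loop_v] linear_cmul[OF linear_loop_v] algebra_simps)
  also have "(\<lambda>a. fC F \<bullet> fst (snd (fst a)) + fD F * (loop_v P F L a + snd (snd a))) = loop_u P F L"
    by (auto simp: loop_u_def fun_eq_iff)
  finally show ?thesis .
qed

lemma linear_loop_y: "linear (loop_y P F L)"
proof -
  have "linear (\<lambda>a. pCy P \<bullet> fst (fst a) + pDyd P \<bullet> fst (snd a) + pDyu P * loop_u P F L a)"
    by (rule linearI)
      (auto simp: linear_add[OF linear_loop_u] linear_cmul[OF linear_loop_u] algebra_simps)
  also have "(\<lambda>a. pCy P \<bullet> fst (fst a) + pDyd P \<bullet> fst (snd a) + pDyu P * loop_u P F L a) = loop_y P F L"
    by (auto simp: loop_y_def fun_eq_iff)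
  finally show ?thesis .
qed

lemma linear_loop_step: "linear (loop_step P F L)"
proof -
  let ?s = "\<lambda>a. (pA P *v fst (fst a) + pBd P *v fst (snd a) + loop_u P F L a *\<^sub>R pBu P,
      fA F *v fst (snd (fst a)) + (loop_v P F L a + snd (snd a)) *\<^sub>R fB F,
      lA L *v fst (snd (snd (fst a))) + snd (snd (snd (fst a))) *\<^sub>R lBw L + loop_y P F L a *\<^sub>R lBy L,
      loop_v P F L a + snd (snd a))"
  have "linear ?s"
    by (rule linearI)
      (auto simp: linear_add[OF linear_loop_u] linear_cmul[OF linear_loop_u]
        linear_add[OF linear_loop_v] linear_cmul[OF linear_loop_v]
        linear_add[OF linear_loop_y] linear_cmul[OF linear_loop_y]
        algebra_simps)
  also have "?s = loop_step P F L"
    by (auto simp: loop_step_def Let_def fun_eq_iff)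
  finally show ?thesis .
qed

text \<open>The number \<open>qn\<close> is arbitrary, so the same step map describes the loop for
  every additive perturbation of \<open>v\<close>, in particular for an average of noises.\<close>

lemma loop_state_Suc:
  assumes wp: "well_posed P F L" and eqs: "loop_equations P F L d s"
    and w: "sig_w (s n) = sig_v (s n) + qn"
  shows "loop_state (s (Suc n)) = loop_step P F L (loop_state (s n), d n, qn)"
proof -
  note e = eqs[unfolded loop_equations_def, rule_format, of n]
  have eu: "fC F \<bullet> sig_xF (s n) + fD F * (sig_v (s n) + qn) = sig_u (s n)"
    and ey: "pCy P \<bullet> sig_x (s n) + pDyd P \<bullet> d n + pDyu P * sig_u (s n) = sig_y (s n)"
    using e w by metis+
  let ?a = "(loop_state (s n), d n, qn)"
  have v: "loop_v P F L ?a = sig_v (s n)"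
  proof -
    \<comment> \<open>The unknown \<open>sig_v\<close> returns through \<open>w\<close>, the control
      input and the sensor output. Collecting it on the left produces the factor that well-posedness
      makes nonzero.\<close>
    have "sig_v (s n) * (1 - lDy L * pDyu P * fD F) = lC L \<bullet> sig_xL (s n) + lDw L * sig_wd (s n)
      + lDy L * (pCy P \<bullet> sig_x (s n) + pDyd P \<bullet> d n + pDyu P * (fC F \<bullet> sig_xF (s n) + fD F * qn))"
    proof -
      have "sig_v (s n) = lC L \<bullet> sig_xL (s n) + lDw L * sig_wd (s n) + lDy L *
         (pCy P \<bullet> sig_x (s n) + pDyd P \<bullet> d n + pDyu P * (fC F \<bullet> sig_xF (s n) + fD F * (sig_v (s n) + qn)))"
        using e w by metis
      then show ?thesis by (simp add: algebra_simps)
    qed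
    then show ?thesis
      using wp by (simp add: loop_v_def loop_state_def well_posed_def field_simps)
  qed
  have u: "loop_u P F L ?a = sig_u (s n)"
    using eu v by (simp add: loop_u_def loop_state_def)
  have y: "loop_y P F L ?a = sig_y (s n)"
    using ey u by (simp add: loop_y_def loop_state_def)
  have "loop_step P F L ?a =
    (pA P *v sig_x (s n) + pBd P *v d n + sig_u (s n) *\<^sub>R pBu P,
     fA F *v sig_xF (s n) + sig_w (s n) *\<^sub>R fB F,
     lA L *v sig_xL (s n) + sig_wd (s n) *\<^sub>R lBw L + sig_y (s n) *\<^sub>R lBy L,
     sig_w (s n))"
    using v u y unfolding w loop_step_def loop_state_def by (simp add: Let_def)
  also have "\<dots> = loop_state (s (Suc n))"
    unfolding loop_state_def using e by metis
  finally show ?thesis by (rule sym)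
qed

text \<open>The map \<open>\<Phi>\<close> of the noise-free loop.\<close>

definition free_loop ::
  "('n::finite, 'd::finite, 'e::finite) plant \<Rightarrow> 'f::finite filter1 \<Rightarrow> 'l::finite filter2
    \<Rightarrow> ('n, 'f, 'l) lstate \<Rightarrow> ('n, 'f, 'l) lstate" where
  "free_loop P F L z = loop_step P F L (z, 0)"

definition input_loop ::
  "('n::finite, 'd::finite, 'e::finite) plant \<Rightarrow> 'f::finite filter1 \<Rightarrow> 'l::finite filter2
    \<Rightarrow> (real ^ 'd) \<times> real \<Rightarrow> ('n, 'f, 'l) lstate" where
  "input_loop P F L r = loop_step P F L (0, r)"

lemma loop_step_split: "loop_step P F L (z, r) = free_loop P F L z + input_loop P F L r"
  unfolding free_loop_def input_loop_def linear_add[OF linear_loop_step, symmetric] by simp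

lemma linear_free_loop: "linear (free_loop P F L)"
  by (rule linearI)
    (auto simp: free_loop_def linear_add[OF linear_loop_step, symmetric]
      linear_cmul[OF linear_loop_step, symmetric])

lemma linear_input_loop: "linear (input_loop P F L)"
  by (rule linearI)
    (auto simp: input_loop_def linear_add[OF linear_loop_step, symmetric]
      linear_cmul[OF linear_loop_step, symmetric])

text \<open>Internal stability speaks about complete signal trajectories, so one is built: its state
  follows the iterates of \<open>free_loop\<close>, and its other signals are the solved loop
  signals at zero input.\<close>

lemma free_loop_stable:
  fixes P :: "('n::finite, 'd::finite, 'e::finite) plant"
    and F :: "'f::finite filter1" and L :: "'l::finite filter2"
  assumes wp: "well_posed P F L" and stable: "internally_stable P F L"
  shows "(\<lambda>n. (free_loop P F L ^^ n) z) \<longlonglongrightarrow> 0"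
proof -
  define t where "t n = (free_loop P F L ^^ n) z" for n
  define s :: "nat \<Rightarrow> ('n, 'e, 'f, 'l) signals" where
    "s n = (let a = (t n, 0::(real^'d) \<times> real) in
       \<lparr> sig_x = fst (t n), sig_xF = fst (snd (t n)), sig_xL = fst (snd (snd (t n))),
         sig_wd = snd (snd (snd (t n))),
         sig_e = pCe P *v fst (t n) + loop_u P F L a *\<^sub>R pDeu P,
         sig_y = loop_y P F L a, sig_u = loop_u P F L a,
         sig_v = loop_v P F L a, sig_w = loop_v P F L a \<rparr>)" for n
  have state: "loop_state (s n) = t n" for n
    by (simp add: s_def loop_state_def Let_def)
  have "loop_equations P F L (\<lambda>_. 0) s"
    unfolding loop_equations_def
  proof
    fix n
    obtain x xF xL wd where tn: "t n = (x, xF, xL, wd)" by (metis surj_pair)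
    have zero: "(0::(real^'d) \<times> real) = (0, 0)" by (simp add: zero_prod_def)
    have tS: "t (Suc n) = loop_step P F L ((x, xF, xL, wd), 0, 0)"
      using tn by (simp add: t_def free_loop_def zero)
    have D: "1 - lDy L * pDyu P * fD F \<noteq> 0" using wp by (simp add: well_posed_def)
    let ?v = "loop_v P F L ((x, xF, xL, wd), 0, 0)"
    \<comment> \<open>Multiplying out the denominator of \<open>loop_v\<close> leads back to the
      implicit loop equation, with \<open>?v\<close> on both sides.\<close>
    have "?v * (1 - lDy L * pDyu P * fD F)
        = lC L \<bullet> xL + lDw L * wd + lDy L * (pCy P \<bullet> x + pDyu P * (fC F \<bullet> xF))"
      using D by (simp add: loop_v_def)
    then have "?v = lC L \<bullet> xL + lDw L * wd + lDy L * (pCy P \<bullet> x + pDyu P * (fC F \<bullet> xF + fD F * ?v))"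
      by (simp add: algebra_simps)
    then have v: "?v = lC L \<bullet> xL + lDw L * wd + lDy L * loop_y P F L ((x, xF, xL, wd), 0, 0)"
      by (simp add: loop_y_def loop_u_def)
    show "sig_x (s (Suc n)) = pA P *v sig_x (s n) + pBd P *v 0 + sig_u (s n) *\<^sub>R pBu P \<and>
     sig_e (s n) = pCe P *v sig_x (s n) + pDed P *v 0 + sig_u (s n) *\<^sub>R pDeu P \<and>
     sig_y (s n) = pCy P \<bullet> sig_x (s n) + pDyd P \<bullet> 0 + pDyu P * sig_u (s n) \<and>
     sig_xF (s (Suc n)) = fA F *v sig_xF (s n) + sig_w (s n) *\<^sub>R fB F \<and>
     sig_u (s n) = fC F \<bullet> sig_xF (s n) + fD F * sig_w (s n) \<and>
     sig_wd (s (Suc n)) = sig_w (s n) \<and>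
     sig_xL (s (Suc n)) =
       lA L *v sig_xL (s n) + sig_wd (s n) *\<^sub>R lBw L + sig_y (s n) *\<^sub>R lBy L \<and>
     sig_v (s n) = lC L \<bullet> sig_xL (s n) + lDw L * sig_wd (s n) + lDy L * sig_y (s n)"
      using v by (simp add: s_def Let_def tS tn zero loop_step_def)
        (simp add: loop_y_def loop_u_def)
  qed
  moreover have "sig_w (s n) = sig_v (s n)" for n
    by (simp add: s_def Let_def)
  ultimately have "(\<lambda>n. loop_state (s n)) \<longlonglongrightarrow> 0"
    using stable by (simp add: internally_stable_def)
  then show ?thesis by (simp add: state t_def)
qed

section \<open>Averaged noise and a criterion for mean-square stability\<close>

lemma average_square_integrable:
  fixes X :: "'i \<Rightarrow> 'a \<Rightarrow> real"
  assumes I: "finite I" "I \<noteq> {}" and X: "\<And>i. i \<in> I \<Longrightarrow> square_integrable M (X i)"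
    and m: "\<And>i. i \<in> I \<Longrightarrow> (\<integral>\<omega>. (X i \<omega>)\<^sup>2 \<partial>M) \<le> m"
  shows "square_integrable M (\<lambda>\<omega>. (\<Sum>i\<in>I. X i \<omega>) / card I)"
    and "(\<integral>\<omega>. ((\<Sum>i\<in>I. X i \<omega>) / card I)\<^sup>2 \<partial>M) \<le> m"
proof -
  have [measurable]: "\<And>i. i \<in> I \<Longrightarrow> X i \<in> borel_measurable M"
    and int: "\<And>i. i \<in> I \<Longrightarrow> integrable M (\<lambda>\<omega>. (X i \<omega>)\<^sup>2)"
    using X by (auto simp: square_integrable_def)
  have c: "real (card I) > 0" using I by (simp add: card_gt_0_iff)
  \<comment> \<open>By Cauchy-Schwarz the square of a mean is at most the mean of the squares, so
    averaging preserves a common bound on second moments.\<close>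
  have le: "((\<Sum>i\<in>I. X i \<omega>) / card I)\<^sup>2 \<le> (\<Sum>i\<in>I. (X i \<omega>)\<^sup>2) / card I" for \<omega>
    using sum_squared_le_sum_of_squares[of "\<lambda>i. X i \<omega>" I] c
    by (simp add: power_divide field_simps power2_eq_square)
  have sum: "integrable M (\<lambda>\<omega>. (\<Sum>i\<in>I. (X i \<omega>)\<^sup>2) / card I)" using int by auto
  then have avg: "integrable M (\<lambda>\<omega>. ((\<Sum>i\<in>I. X i \<omega>) / card I)\<^sup>2)"
    by (rule Bochner_Integration.integrable_bound) (use le in \<open>auto intro!: AE_I2 simp del: abs_divide simp: abs_of_nonneg sum_nonneg\<close>)
  then show "square_integrable M (\<lambda>\<omega>. (\<Sum>i\<in>I. X i \<omega>) / card I)"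
    by (simp add: square_integrable_def power_divide)
  have "(\<integral>\<omega>. ((\<Sum>i\<in>I. X i \<omega>) / card I)\<^sup>2 \<partial>M) \<le> (\<integral>\<omega>. (\<Sum>i\<in>I. (X i \<omega>)\<^sup>2) / card I \<partial>M)"
    by (intro integral_mono avg sum le)
  also have "\<dots> = (\<Sum>i\<in>I. (\<integral>\<omega>. (X i \<omega>)\<^sup>2 \<partial>M)) / card I"
    using int by (simp add: Bochner_Integration.integral_sum)
  also have "\<dots> \<le> m"
    using sum_bounded_above[of I "\<lambda>i. (\<integral>\<omega>. (X i \<omega>)\<^sup>2 \<partial>M)" m] m c
    by (simp add: divide_le_eq mult.commute)
  finally show "(\<integral>\<omega>. ((\<Sum>i\<in>I. X i \<omega>) / card I)\<^sup>2 \<partial>M) \<le> m" .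
qed

text \<open>Each product of two coordinates is dominated by the squared norm, so all entries of the
  second-moment matrix are bounded by \<open>K\<close>. The norm of a matrix is at most the sum of
  its absolute entries.\<close>

lemma mean_square_stableI:
  fixes x :: "nat \<Rightarrow> 'w \<Rightarrow> real ^ 'n::finite"
  assumes x: "\<And>n. square_integrable M (x n)" and K: "\<And>n. (\<integral>\<omega>. (norm (x n \<omega>))\<^sup>2 \<partial>M) \<le> K"
  shows "mean_square_stable M x"
proof -
  have [measurable]: "x n \<in> borel_measurable M" for n
    using x by (simp add: square_integrable_def)
  have [measurable]: "(\<lambda>\<omega>. x n \<omega> $ i) \<in> borel_measurable M" for n i
  proof -
    have "(\<lambda>\<omega>. x n \<omega> \<bullet> axis i 1) \<in> borel_measurable M" by measurable
    then show ?thesis by (simp add: inner_axis)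
  qed
  have int2: "integrable M (\<lambda>\<omega>. (norm (x n \<omega>))\<^sup>2)" for n
    using x by (simp add: square_integrable_def)
  have le: "\<bar>x n \<omega> $ i * x n \<omega> $ j\<bar> \<le> (norm (x n \<omega>))\<^sup>2" for n \<omega> i j
    unfolding abs_mult power2_eq_square by (intro mult_mono component_le_norm_cart) auto
  have int: "integrable M (\<lambda>\<omega>. x n \<omega> $ i * x n \<omega> $ j)" for n i j
    using int2[of n] by (rule Bochner_Integration.integrable_bound) (auto intro!: AE_I2 le)
  have entry: "\<bar>\<integral>\<omega>. x n \<omega> $ i * x n \<omega> $ j \<partial>M\<bar> \<le> K" for n i j
  proof -
    have "\<bar>\<integral>\<omega>. x n \<omega> $ i * x n \<omega> $ j \<partial>M\<bar> \<le> (\<integral>\<omega>. \<bar>x n \<omega> $ i * x n \<omega> $ j\<bar> \<partial>M)"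
      by (rule integral_abs_bound)
    also have "\<dots> \<le> (\<integral>\<omega>. (norm (x n \<omega>))\<^sup>2 \<partial>M)"
      by (intro integral_mono int2 le integrable_abs int)
    finally show ?thesis using K[of n] by linarith
  qed
  have "norm (\<chi> i j. \<integral>\<omega>. x n \<omega> $ i * x n \<omega> $ j \<partial>M) \<le> (\<Sum>i\<in>(UNIV::'n set). \<Sum>j\<in>(UNIV::'n set). K)" for n
  proof -
    have "norm (\<chi> i j. \<integral>\<omega>. x n \<omega> $ i * x n \<omega> $ j \<partial>M)
        \<le> (\<Sum>i\<in>UNIV. norm ((\<chi> i j. \<integral>\<omega>. x n \<omega> $ i * x n \<omega> $ j \<partial>M) $ i))"
      unfolding norm_vec_def by (rule L2_set_le_sum) simp
    also have "\<dots> \<le> (\<Sum>i\<in>UNIV. \<Sum>j\<in>UNIV. \<bar>(\<chi> i j. \<integral>\<omega>. x n \<omega> $ i * x n \<omega> $ j \<partial>M) $ i $ j\<bar>)"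
      by (intro sum_mono norm_le_l1_cart)
    also have "\<dots> \<le> (\<Sum>i\<in>(UNIV::'n set). \<Sum>j\<in>(UNIV::'n set). K)"
      by (intro sum_mono) (simp add: entry)
    finally show ?thesis .
  qed
  then have "bounded (range (\<lambda>n. (\<chi> i j. \<integral>\<omega>. x n \<omega> $ i * x n \<omega> $ j \<partial>M) :: real ^ 'n ^ 'n))"
    unfolding bounded_iff by auto
  with int show ?thesis by (simp add: mean_square_stable_def)
qed

section \<open>Mean-square stability of the loop closed through any \<open>k'\<close>
  descriptions\<close>

theorem lemma1:
  fixes M :: "'w measure"
    and P :: "('n::finite, 'd::finite, 'e::finite) plant"
    and F :: "'f::finite filter1"
    and L :: "'l::finite filter2"
    and \<gamma> \<sigma>q \<sigma> :: real
    and \<xi> :: "'w \<Rightarrow> (real ^ 'n) \<times> (real ^ 'f) \<times> (real ^ 'l) \<times> real"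
    and d :: "nat \<Rightarrow> 'w \<Rightarrow> real ^ 'd"
    and q :: "nat \<Rightarrow> 'w \<Rightarrow> real"
    and s0 :: "nat \<Rightarrow> 'w \<Rightarrow> ('n, 'e, 'f, 'l) signals"
    and k k' :: nat
    and qs :: "nat \<Rightarrow> nat \<Rightarrow> 'w \<Rightarrow> real"
    and s :: "nat set \<Rightarrow> nat \<Rightarrow> 'w \<Rightarrow> ('n, 'e, 'f, 'l) signals"
    and y :: "nat set \<Rightarrow> nat \<Rightarrow> nat \<Rightarrow> 'w \<Rightarrow> real"
  assumes system: "networked_system M P F L \<gamma> \<xi> d \<sigma>q q s0"
    and k': "1 \<le> k'" "k' \<le> k"
    and noise_indep: "prob_space.indep_vars M (\<lambda>_. \<Pi>\<^sub>M n\<in>UNIV. borel) (\<lambda>i \<omega> n. qs i n \<omega>) {1..k}"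
    and noise_mean: "\<And>i n. i \<in> {1..k} \<Longrightarrow> prob_space.expectation M (qs i n) = 0"
    and noise_finite: "\<And>i n. i \<in> {1..k} \<Longrightarrow> integrable M (\<lambda>\<omega>. (qs i n \<omega>)\<^sup>2)"
    and noise_variance: "\<And>i n. i \<in> {1..k} \<Longrightarrow> prob_space.variance M (qs i n) = \<sigma>\<^sup>2"
    and descriptions: "\<And>I i n \<omega>. I \<subseteq> {1..k} \<Longrightarrow> card I = k' \<Longrightarrow> i \<in> {1..k} \<Longrightarrow> \<omega> \<in> space M \<Longrightarrow>
      y I i n \<omega> = sig_v (s I n \<omega>) + qs i n \<omega>"
    and loops: "\<And>I. I \<subseteq> {1..k} \<Longrightarrow> card I = k' \<Longrightarrow> closed_through M P F L \<xi> d I (y I) (s I)"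
    and v_gaussian: "\<And>I n. I \<subseteq> {1..k} \<Longrightarrow> card I = k' \<Longrightarrow> gaussian_rv M (\<lambda>\<omega>. sig_v (s I n \<omega>))"
    and encodings: "\<And>I n. I \<subseteq> {1..k} \<Longrightarrow> card I = k' \<Longrightarrow>
      independent_encodings M k (\<lambda>\<omega>. sig_v (s I n \<omega>)) (\<lambda>i. y I i n)"
    and bound: "\<sigma>\<^sup>2 \<le> \<gamma> * real k' * (H2_norm (tf_LyP21S P F L))\<^sup>2 /
      ((H2_norm (\<lambda>z. tf_S P F L z - 1))\<^sup>2 * (\<gamma> - (H2_norm (\<lambda>z. tf_S P F L z - 1))\<^sup>2))"
  shows "stabilizing_code M P F L \<xi> d k k' s y"
proof -
  interpret prob_space M using system by (simp add: networked_system_def)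
  have wp: "well_posed P F L" and stable: "internally_stable P F L"
    and gauss: "jointly_gaussian M \<xi> d" and white: "unit_white_noise M d"
    using system by (simp_all add: networked_system_def)
  have \<xi>: "square_integrable M \<xi>"
  proof (rule square_integrable_componentwise)
    fix b :: "('n, 'f, 'l) lstate"
    show "square_integrable M (\<lambda>\<omega>. \<xi> \<omega> \<bullet> b)"
      \<comment> \<open>Horizon 0 empties the disturbance sum and leaves a functional of
        \<open>\<xi>\<close> alone.\<close>
      using gauss[unfolded jointly_gaussian_def, rule_format, of b "\<lambda>_. 0" 0]
      by (simp add: gaussian_rv_square_integrable inner_commute)
  qed
  have d_comp: "square_integrable M (\<lambda>\<omega>. d n \<omega> \<bullet> b)" for n b
  proof -
    have "gaussian_rv M (\<lambda>\<omega>. d n \<omega> \<bullet> b)"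
      \<comment> \<open>The coefficients select time \<open>n\<close>; the horizon is
        \<open>Suc n\<close> because the sum runs over indices strictly below it.\<close>
      using gauss[unfolded jointly_gaussian_def, rule_format, of 0 "\<lambda>m. if m = n then b else 0" "Suc n"]
      by (simp add: inner_commute)
    then show ?thesis by (rule gaussian_rv_square_integrable)
  qed
  have d: "square_integrable M (d n)" for n
    using d_comp by (rule square_integrable_componentwise)
  have d_moment: "expectation (\<lambda>\<omega>. (norm (d n \<omega>))\<^sup>2) = DIM(real ^ 'd)" for n
  proof -
    have "expectation (\<lambda>\<omega>. (d n \<omega> \<bullet> b)\<^sup>2) = 1" if "b \<in> Basis" for b
      using that white by (auto simp: Basis_vec_def inner_axis unit_white_noise_def power2_eq_square)
    then show ?thesis
      using d_comp by (subst square_integrable_componentwise(2)) auto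
  qed
  have qs: "square_integrable M (qs i n)" if "i \<in> {1..k}" for i n
  proof -
    \<comment> \<open>The independence hypothesis carries measurability of each noise as a
      sequence-valued map; projecting to coordinate \<open>n\<close> gives it for
      \<open>qs i n\<close>.\<close>
    have "random_variable (\<Pi>\<^sub>M n\<in>UNIV. borel) (\<lambda>\<omega> n. qs i n \<omega>)"
      using noise_indep that by (simp add: indep_vars_def)
    then have "(\<lambda>\<omega>. (\<lambda>n. qs i n \<omega>) n) \<in> borel_measurable M"
      by (rule measurable_compose) (rule measurable_component_singleton, simp)
    then show ?thesis using noise_finite[OF that] by (simp add: square_integrable_def)
  qed
  have qs_moment: "expectation (\<lambda>\<omega>. (qs i n \<omega>)\<^sup>2) = \<sigma>\<^sup>2" if "i \<in> {1..k}" for i n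
    using noise_variance[OF that, of n] noise_mean[OF that, of n] by simp
  have "mean_square_stable M (\<lambda>n \<omega>. sig_x (s I n \<omega>))" if I: "I \<subseteq> {1..k}" "card I = k'" for I
  proof -
    \<comment> \<open>Nonemptiness comes from \<open>1 \<le> k'\<close> and keeps the divisor
      \<open>card I\<close> of the average nonzero.\<close>
    have fin: "finite I" "I \<noteq> {}" using I k' finite_subset by auto
    define r where "r n \<omega> = (d n \<omega>, (\<Sum>i\<in>I. qs i n \<omega>) / card I)" for n \<omega>
    define z where "z n \<omega> = loop_state (s I n \<omega>)" for n \<omega>
    have "square_integrable M (qs i n)" "expectation (\<lambda>\<omega>. (qs i n \<omega>)\<^sup>2) \<le> \<sigma>\<^sup>2" if "i \<in> I" for i n
      using qs[of i n] qs_moment[of i n] that I(1) by auto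
    note average_square_integrable[OF fin this]
    then have avg: "square_integrable M (\<lambda>\<omega>. (\<Sum>i\<in>I. qs i n \<omega>) / card I)"
      "expectation (\<lambda>\<omega>. ((\<Sum>i\<in>I. qs i n \<omega>) / card I)\<^sup>2) \<le> \<sigma>\<^sup>2" for n
      by simp_all
    have r: "square_integrable M (r n)"
      "expectation (\<lambda>\<omega>. (norm (r n \<omega>))\<^sup>2) \<le> DIM(real ^ 'd) + \<sigma>\<^sup>2" for n
      unfolding r_def using square_integrable_Pair[OF d avg(1), of n n] avg(2)[of n] d_moment[of n]
      by (auto simp: power_divide)
    obtain B where B: "\<And>x. norm (input_loop P F L x) \<le> B * norm x"
      using linear_bounded[OF linear_input_loop] by blast
    have g: "square_integrable M (\<lambda>\<omega>. input_loop P F L (r n \<omega>))"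
      "expectation (\<lambda>\<omega>. (norm (input_loop P F L (r n \<omega>)))\<^sup>2) \<le> B\<^sup>2 * (DIM(real ^ 'd) + \<sigma>\<^sup>2)" for n
      using square_integrable_linear[OF linear_input_loop B r(1), of n]
        mult_left_mono[OF r(2), of "B\<^sup>2" n] by auto
    have rec: "z (Suc n) \<omega> = free_loop P F L (z n \<omega>) + input_loop P F L (r n \<omega>)"
      if \<omega>: "\<omega> \<in> space M" for n \<omega>
    proof -
      have eqs: "loop_equations P F L (\<lambda>n. d n \<omega>) (\<lambda>n. s I n \<omega>)"
        and w: "sig_w (s I n \<omega>) = (\<Sum>i\<in>I. y I i n \<omega>) / card I"
        using loops[OF I] \<omega> by (auto simp: closed_through_def)
      \<comment> \<open>All descriptions share the same \<open>v\<close>, which the average returns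
        unchanged; only the noises are averaged, and \<open>w\<close> gets the form required by
        \<open>loop_state_Suc\<close>.\<close>
      have "(\<Sum>i\<in>I. y I i n \<omega>) = (\<Sum>i\<in>I. sig_v (s I n \<omega>) + qs i n \<omega>)"
        using descriptions[OF I _ \<omega>] I(1) by (intro sum.cong) auto
      then have "sig_w (s I n \<omega>) = sig_v (s I n \<omega>) + (\<Sum>i\<in>I. qs i n \<omega>) / card I"
        unfolding w using fin by (simp add: sum.distrib add_divide_distrib)
      from loop_state_Suc[OF wp eqs this] show ?thesis
        by (simp add: z_def r_def loop_step_split)
    qed
    have "square_integrable M (z 0) \<longleftrightarrow> square_integrable M \<xi>"
      unfolding square_integrable_def using loops[OF I]
      by (intro conj_cong measurable_cong Bochner_Integration.integrable_cong)
        (auto simp: closed_through_def z_def)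
    with \<xi> have z0: "square_integrable M (z 0)" by simp
    note bounded = linear_recursion_second_moment_bounded[of "free_loop P F L" M z, OF
        linear_free_loop free_loop_stable[OF wp stable] z0 g rec]
    obtain K where K: "\<And>n. expectation (\<lambda>\<omega>. (norm (z n \<omega>))\<^sup>2) \<le> K"
      using bounded(2) by blast
    have x: "sig_x (s I n \<omega>) = fst (z n \<omega>)" for n \<omega>
      by (simp add: z_def loop_state_def)
    \<comment> \<open>The factor 1 is written out to match the constant \<open>B\<close> in
      \<open>square_integrable_linear\<close>.\<close>
    have fst: "norm (fst a) \<le> 1 * norm a" for a :: "('n, 'f, 'l) lstate"
      using norm_fst_le[of "fst a" "snd a"] by simp
    show ?thesis
      unfolding x
    proof (rule mean_square_stableI)
      show "square_integrable M (\<lambda>\<omega>. fst (z n \<omega>))" for n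
        by (rule square_integrable_linear(1)[OF linear_fst fst bounded(1)])
      show "expectation (\<lambda>\<omega>. (norm (fst (z n \<omega>)))\<^sup>2) \<le> K" for n
        using square_integrable_linear(2)[OF linear_fst fst bounded(1), of n] K[of n] by simp
    qed
  qed
  then show ?thesis using loops by (simp add: stabilizing_code_def)
qed

end
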